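(* Let $R$ be an even skew-invertible involutive symmetry of bi-rank $(m|0)$ on $V$, $\dim_{\mathbb C}V=N$, let $u_1,\dots,u_K$ be pairwise distinct complex numbers, and let $M(1),\dots,M(K)$ be $N\times N$ matrices whose entries generate the unital associative algebra with the relations $$M(k)_{\overline1}M(l)_{\overline2}=M(l)_{\overline2}M(k)_{\overline1},\quad k\ne l,$$ $$M(k)_{\overline1}M(k)_{\overline2}-M(k)_{\overline2}M(k)_{\overline1}=M(k)_{\overline1}R-M(k)_{\overline2}R,\quad 1\le k\le K.$$ Then the elements $$H_k=\sum_{l\ne k}\mathrm{Tr}_R\,\frac{M(k)M(l)}{u_k-u_l},\qquad 1\le k\le K,$$ commute with each other.
   Context: Let $V$ be a complex vector space of dimension $N$. An involutive symmetry is an operator $R\in\mathrm{End}(V^{\otimes2})$ with $R_1R_2R_1=R_2R_1R_2$ in $\mathrm{End}(V^{\otimes3})$ and $R^2=I$, where $R_k=R_{k\,k+1}$ denotes $R$ acting in the positions $k,k+1$ of a tensor power of $V$. Skew-symmetrizers: $A^{(1)}=I$, $A^{(k+1)}_{1\dots k+1}=\frac{k}{k+1}A^{(k)}_{1\dots k}\left(\frac1k I-R_k\right)A^{(k)}_{1\dots k}$, $k\ge1$. $R$ is skew-invertible if there is $\Psi\in\mathrm{End}(V^{\otimes2})$ with $\mathrm{Tr}_{(2)}R_{12}\Psi_{23}=P_{13}=\mathrm{Tr}_{(2)}\Psi_{12}R_{23}$ ($P$ is the flip). Then $C=\mathrm{Tr}_{(2)}\Psi_{12}$ satisfies $\mathrm{Tr}_{(2)}R_{12}C_2=I_1$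 and $R_kC_kC_{k+1}=C_kC_{k+1}R_k$. $R$ is even of bi-rank $(m|0)$ if $A^{(m+1)}=0$ and $\mathrm{rank}\,A^{(m)}=1$; then $\mathrm{Tr}\,C=m$. The $R$-trace of an $N\times N$ matrix $X$ with entries in an algebra is $\mathrm{Tr}_RX=\mathrm{Tr}(CX)$. Overlined copies of an $N\times N$ matrix $X$: $X_{\overline1}=X_1$ (i.e. $X\otimes I$), $X_{\overline2}=R_1X_{\overline1}R_1^{-1}$. *)

theory Defs
  imports
    "HOL-Analysis.Analysis"
    "HOL-Algebra.QuotRing"
    "HOL-Library.Poly_Mapping"
    "HOL-Library.Function_Algebras"
begin

section \<open>Operators on tensor powers of \<open>V\<close>\<close>

text \<open>
  \<open>V\<close> has a fixed basis indexed by the finite type \<open>'n\<close> (so \<open>N = CARD('n)\<close>); operators on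
  \<open>V\<close>, \<open>V \<otimes> V\<close>, \<open>V \<otimes> V \<otimes> V\<close> are matrices indexed by \<open>'n\<close>, \<open>'n \<times> 'n\<close>, \<open>'n \<times> 'n \<times> 'n\<close>,
  acting on columns of coordinates, so that composition is \<open>**\<close>.
\<close>

definition leg1 :: "'a::zero^'n::finite^'n \<Rightarrow> 'a^('n \<times> 'n)^('n \<times> 'n)" where
  "leg1 X = (\<chi> p q. if snd p = snd q then X $ fst p $ fst q else 0)"

definition op12 :: "'a::zero^('n::finite \<times> 'n)^('n \<times> 'n) \<Rightarrow> 'a^('n \<times> 'n \<times> 'n)^('n \<times> 'n \<times> 'n)" where
  "op12 X = (\<chi> p q. case (p, q) of ((a, b, c), (a', b', c')) \<Rightarrow>
     if c = c' then X $ (a, b) $ (a', b') else 0)"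

definition op23 :: "'a::zero^('n::finite \<times> 'n)^('n \<times> 'n) \<Rightarrow> 'a^('n \<times> 'n \<times> 'n)^('n \<times> 'n \<times> 'n)" where
  "op23 X = (\<chi> p q. case (p, q) of ((a, b, c), (a', b', c')) \<Rightarrow>
     if a = a' then X $ (b, c) $ (b', c') else 0)"

text \<open>
  Partial traces over the second position, of operators on \<open>V \<otimes> V \<otimes> V\<close> (the result acts in the
  positions 1 and 3) and on \<open>V \<otimes> V\<close>.
\<close>

definition Tr2_of3 ::
  "'a::comm_monoid_add^('n::finite \<times> 'n \<times> 'n)^('n \<times> 'n \<times> 'n) \<Rightarrow> 'a^('n \<times> 'n)^('n \<times> 'n)" where
  "Tr2_of3 X = (\<chi> p q. \<Sum>b\<in>UNIV. X $ (fst p, b, snd p) $ (fst q, b, snd q))"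

definition Tr2_of2 :: "'a::comm_monoid_add^('n::finite \<times> 'n)^('n \<times> 'n) \<Rightarrow> 'a^'n^'n" where
  "Tr2_of2 X = (\<chi> a a'. \<Sum>b\<in>UNIV. X $ (a, b) $ (a', b))"

definition flip :: "complex^('n::finite \<times> 'n)^('n \<times> 'n)" where
  "flip = (\<chi> p q. if fst p = snd q \<and> snd p = fst q then 1 else 0)"

definition involutive_symmetry :: "complex^('n::finite \<times> 'n)^('n \<times> 'n) \<Rightarrow> bool" where
  "involutive_symmetry R \<longleftrightarrow>
     op12 R ** op23 R ** op12 R = op23 R ** op12 R ** op23 R \<and> R ** R = mat 1"

definition skew_inverse ::
  "complex^('n::finite \<times> 'n)^('n \<times> 'n) \<Rightarrow> complex^('n \<times> 'n)^('n \<times> 'n) \<Rightarrow> bool" where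
  "skew_inverse R \<Psi> \<longleftrightarrow>
     Tr2_of3 (op12 R ** op23 \<Psi>) = flip \<and> Tr2_of3 (op12 \<Psi> ** op23 R) = flip"


section \<open>Skew-symmetrizers and bi-rank\<close>

text \<open>
  On \<open>V\<^sup>\<otimes>\<^sup>p\<close> with \<open>p\<close> varying, operators are matrices indexed by lists of length \<open>p\<close>; entries at
  lists of any other length are zero.
\<close>

type_synonym 'n tens_op = "'n list \<Rightarrow> 'n list \<Rightarrow> complex"

definition tens_id :: "nat \<Rightarrow> 'n tens_op" where
  "tens_id p xs ys = (if xs = ys \<and> length xs = p then 1 else 0)"

definition tens_mult :: "nat \<Rightarrow> 'n::finite tens_op \<Rightarrow> 'n tens_op \<Rightarrow> 'n tens_op" where
  "tens_mult p X Y xs ys = (\<Sum>zs | length zs = p. X xs zs * Y zs ys)"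

text \<open>\<open>R\<^sub>k\<close> on \<open>V\<^sup>\<otimes>\<^sup>p\<close>, for \<open>1 \<le> k < p\<close>; positions are counted from 1, list entries from 0.\<close>

definition R_at ::
  "complex^('n::finite \<times> 'n)^('n \<times> 'n) \<Rightarrow> nat \<Rightarrow> nat \<Rightarrow> 'n tens_op" where
  "R_at R k p xs ys =
     (if length xs = p \<and> length ys = p \<and>
         take (k - 1) xs = take (k - 1) ys \<and> drop (k + 1) xs = drop (k + 1) ys
      then R $ (xs ! (k - 1), xs ! k) $ (ys ! (k - 1), ys ! k) else 0)"

text \<open>\<open>X \<mapsto> X \<otimes> I\<close> from operators on \<open>V\<^sup>\<otimes>\<^sup>k\<close> to operators on \<open>V\<^sup>\<otimes>\<^sup>(\<^sup>k\<^sup>+\<^sup>1\<^sup>)\<close>.\<close>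

definition tens_extend :: "nat \<Rightarrow> 'n tens_op \<Rightarrow> 'n tens_op" where
  "tens_extend k X xs ys =
     (if length xs = k + 1 \<and> length ys = k + 1 \<and> last xs = last ys
      then X (butlast xs) (butlast ys) else 0)"

text \<open>The value at 0 is a convention that is never used.\<close>

fun skew_symmetrizer :: "complex^('n::finite \<times> 'n)^('n \<times> 'n) \<Rightarrow> nat \<Rightarrow> 'n tens_op" where
  "skew_symmetrizer R 0 = tens_id 0"
| "skew_symmetrizer R (Suc 0) = tens_id 1"
| "skew_symmetrizer R (Suc (Suc j)) =
     (let k = Suc j;
          A = tens_extend k (skew_symmetrizer R k);
          B = (\<lambda>xs ys. 1 / of_nat k * tens_id (k + 1) xs ys - R_at R k (k + 1) xs ys)
      in (\<lambda>xs ys. of_nat k / of_nat (k + 1) *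
            tens_mult (k + 1) A (tens_mult (k + 1) B A) xs ys))"

definition tensor_scale :: "complex \<Rightarrow> ('n list \<Rightarrow> complex) \<Rightarrow> 'n list \<Rightarrow> complex" where
  "tensor_scale c v = (\<lambda>xs. c * v xs)"

global_interpretation tensor: vector_space "tensor_scale :: complex \<Rightarrow> ('n list \<Rightarrow> complex) \<Rightarrow> _"
  defines tensor_dim = "tensor.dim"
  by unfold_locales (auto simp: tensor_scale_def fun_eq_iff algebra_simps)

definition tens_apply :: "nat \<Rightarrow> 'n::finite tens_op \<Rightarrow> ('n list \<Rightarrow> complex) \<Rightarrow> 'n list \<Rightarrow> complex" where
  "tens_apply p X v = (\<lambda>xs. \<Sum>ys | length ys = p. X xs ys * v ys)"

definition tens_rank :: "nat \<Rightarrow> 'n::finite tens_op \<Rightarrow> nat" where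
  "tens_rank p X = tensor_dim (range (tens_apply p X))"

definition even_birank :: "complex^('n::finite \<times> 'n)^('n \<times> 'n) \<Rightarrow> nat \<Rightarrow> bool" where
  "even_birank R m \<longleftrightarrow> m \<ge> 1 \<and>
     skew_symmetrizer R (m + 1) = (\<lambda>xs ys. 0) \<and> tens_rank m (skew_symmetrizer R m) = 1"


section \<open>The algebra generated by the entries of \<open>M(1), \<dots>, M(K)\<close>\<close>

text \<open>
  Words form the free monoid, written additively because \<open>\<Rightarrow>\<^sub>0\<close> takes an additive monoid of
  exponents; the convolution product of \<open>'x word0 \<Rightarrow>\<^sub>0 complex\<close> is then that of the free
  unital associative algebra on \<open>'x\<close>.
\<close>

datatype 'x word0 = Word0 (letters: "'x list")

instantiation word0 :: (type) monoid_add
begin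

definition zero_word0 :: "'a word0" where
  "0 = Word0 []"

definition plus_word0 :: "'a word0 \<Rightarrow> 'a word0 \<Rightarrow> 'a word0" where
  "v + w = Word0 (letters v @ letters w)"

instance
  by standard (auto simp: zero_word0_def plus_word0_def)

end

text \<open>The generator \<open>(k, i, j)\<close> is the entry of \<open>M(k)\<close> in row \<open>i\<close> and column \<open>j\<close>.\<close>

type_synonym ('k, 'n) free_alg = "('k \<times> 'n \<times> 'n) word0 \<Rightarrow>\<^sub>0 complex"

definition scalar :: "complex \<Rightarrow> ('k, 'n) free_alg" where
  "scalar c = Poly_Mapping.single 0 c"

definition Mgen :: "'k \<Rightarrow> ('k, 'n::finite) free_alg^'n^'n" where
  "Mgen k = (\<chi> i j. Poly_Mapping.single (Word0 [(k, i, j)]) 1)"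

definition scalar_mat :: "complex^'c::finite^'r::finite \<Rightarrow> ('k, 'n) free_alg^'c^'r" where
  "scalar_mat A = (\<chi> i j. scalar (A $ i $ j))"

definition over1 :: "('k, 'n::finite) free_alg^'n^'n \<Rightarrow> ('k, 'n) free_alg^('n \<times> 'n)^('n \<times> 'n)" where
  "over1 X = leg1 X"

definition over2 :: "complex^('n::finite \<times> 'n)^('n \<times> 'n) \<Rightarrow>
    ('k, 'n) free_alg^'n^'n \<Rightarrow> ('k, 'n) free_alg^('n \<times> 'n)^('n \<times> 'n)" where
  "over2 R X = scalar_mat R ** over1 X ** scalar_mat (matrix_inv R)"

definition mixed_relator :: "complex^('n::finite \<times> 'n)^('n \<times> 'n) \<Rightarrow>
    'k \<Rightarrow> 'k \<Rightarrow> ('k, 'n) free_alg^('n \<times> 'n)^('n \<times> 'n)" where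
  "mixed_relator R k l =
     over1 (Mgen k) ** over2 R (Mgen l) - over2 R (Mgen l) ** over1 (Mgen k)"

definition same_relator :: "complex^('n::finite \<times> 'n)^('n \<times> 'n) \<Rightarrow>
    'k \<Rightarrow> ('k, 'n) free_alg^('n \<times> 'n)^('n \<times> 'n)" where
  "same_relator R k =
     (over1 (Mgen k) ** over2 R (Mgen k) - over2 R (Mgen k) ** over1 (Mgen k))
     - (over1 (Mgen k) ** scalar_mat R - over2 R (Mgen k) ** scalar_mat R)"

definition relators :: "complex^('n::finite \<times> 'n)^('n \<times> 'n) \<Rightarrow> ('k, 'n) free_alg set" where
  "relators R = {mixed_relator R k l $ p $ q | k l p q. k \<noteq> l}
              \<union> {same_relator R k $ p $ q | k p q. True}"

definition free_ring :: "('k, 'n) free_alg ring" where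
  "free_ring = \<lparr>carrier = UNIV, mult = (*), one = 1, zero = 0, add = (+)\<rparr>"

definition rel_ideal :: "complex^('n::finite \<times> 'n)^('n \<times> 'n) \<Rightarrow> ('k, 'n) free_alg set" where
  "rel_ideal R = Idl\<^bsub>free_ring\<^esub> (relators R)"

definition gaudin_alg :: "complex^('n::finite \<times> 'n)^('n \<times> 'n) \<Rightarrow> ('k, 'n) free_alg set ring" where
  "gaudin_alg R = free_ring Quot rel_ideal R"

text \<open>The canonical homomorphism from the free algebra.\<close>

definition to_alg :: "complex^('n::finite \<times> 'n)^('n \<times> 'n) \<Rightarrow>
    ('k, 'n) free_alg \<Rightarrow> ('k, 'n) free_alg set" where
  "to_alg R x = rel_ideal R +>\<^bsub>free_ring\<^esub> x"


section \<open>The elements \<open>H\<^sub>k\<close>\<close>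

text \<open>\<open>\<Psi>\<close> is a skew inverse of \<open>R\<close>; it is unique, and \<open>C = Tr2_of2 \<Psi>\<close>.\<close>

definition R_trace :: "complex^('n::finite \<times> 'n)^('n \<times> 'n) \<Rightarrow>
    ('k, 'n) free_alg^'n^'n \<Rightarrow> ('k, 'n) free_alg" where
  "R_trace \<Psi> X = trace (scalar_mat (Tr2_of2 \<Psi>) ** X)"

definition Ham :: "complex^('n::finite \<times> 'n)^('n \<times> 'n) \<Rightarrow> complex^('n \<times> 'n)^('n \<times> 'n) \<Rightarrow>
    ('k::finite \<Rightarrow> complex) \<Rightarrow> 'k \<Rightarrow> ('k, 'n) free_alg set" where
  "Ham R \<Psi> u k = to_alg R
     (\<Sum>l\<in>UNIV - {k}. scalar (1 / (u k - u l)) * R_trace \<Psi> (Mgen k ** Mgen l))"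

end

theory Submission
  imports Defs
begin

text \<open>
  The elements \<open>\<Omega>\<^sub>k\<^sub>l = Tr\<^sub>R M(k) M(l)\<close> satisfy the infinitesimal braid relations: \<open>\<Omega>\<^sub>k\<^sub>l = \<Omega>\<^sub>l\<^sub>k\<close>,
  \<open>[\<Omega>\<^sub>k\<^sub>l, \<Omega>\<^sub>p\<^sub>q] = 0\<close> for disjoint pairs, and \<open>[\<Omega>\<^sub>k\<^sub>l, \<Omega>\<^sub>k\<^sub>p + \<Omega>\<^sub>l\<^sub>p] = 0\<close>. As for the classical Gaudin
  model, \<open>[H\<^sub>k, H\<^sub>l] = 0\<close> then follows from a partial fraction identity in the \<open>u\<^sub>k\<close>.

  Products of two \<open>R\<close>-traces are computed in two tensor positions: with \<open>C = Tr\<^sub>2 \<Psi>\<close>,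
  \<open>Tr\<^sub>R X Tr\<^sub>R Y\<close> is the trace of \<open>C\<^sub>1 C\<^sub>2 X\<^sub>1 R Y\<^sub>1 R\<close>, because \<open>Tr\<^sub>2 (C\<^sub>2 R Y\<^sub>1 R) = Tr (C Y) I\<close>. Hence the
  relations between the overlined matrices give commutators of the \<open>\<Omega>\<^sub>k\<^sub>l\<close>; the terms that remain cancel
  because \<open>R\<close> commutes with \<open>C\<^sub>1 C\<^sub>2\<close>, and because \<open>Tr\<^sub>2 (R C\<^sub>2) = I\<close>.
\<close>


section \<open>Traces of a skew-invertible involutive symmetry\<close>

lemma sum_UNIV_prod:
  fixes f :: "'a::finite \<times> 'b::finite \<Rightarrow> 'c::comm_monoid_add"
  shows "(\<Sum>p\<in>UNIV. f p) = (\<Sum>x\<in>UNIV. \<Sum>y\<in>UNIV. f (x, y))"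
  by (simp add: sum.cartesian_product)

lemma mult_if_0:
  "(if P then x else 0) * y = (if P then x * y else (0::'a::semiring_0))"
  "y * (if P then x else 0) = (if P then y * x else (0::'a::semiring_0))"
  by simp_all

lemma sum_if_0: "(\<Sum>x\<in>A. if P then f x else 0) = (if P then sum f A else (0::'a::comm_monoid_add))"
  by simp

section \<open>Braid, involution and skew-inverse identities in coordinates\<close>

lemma op12_op23_entry:
  fixes X Y :: "'a::semiring_1^('n::finite \<times> 'n)^('n \<times> 'n)"
  shows "(op12 X ** op23 Y) $ (a, b, c) $ (a', b', c') = (\<Sum>y\<in>UNIV. X $ (a, b) $ (a', y) * Y $ (y, c) $ (b', c'))"
  by (simp add: matrix_matrix_mult_def op12_def op23_def sum_UNIV_prod mult_if_0 sum_if_0)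

lemma op12_mult_entry:
  fixes X :: "'a::semiring_1^('n::finite \<times> 'n)^('n \<times> 'n)"
  shows "(op12 X ** Y) $ (a, b, c) $ q = (\<Sum>x\<in>UNIV. \<Sum>y\<in>UNIV. X $ (a, b) $ (x, y) * Y $ (x, y, c) $ q)"
  by (simp add: matrix_matrix_mult_def op12_def op23_def sum_UNIV_prod mult_if_0 sum_if_0)

lemma op23_mult_entry:
  fixes X :: "'a::semiring_1^('n::finite \<times> 'n)^('n \<times> 'n)"
  shows "(op23 X ** Y) $ (a, b, c) $ q = (\<Sum>x\<in>UNIV. \<Sum>y\<in>UNIV. X $ (b, c) $ (x, y) * Y $ (a, x, y) $ q)"
  by (simp add: matrix_matrix_mult_def op12_def op23_def sum_UNIV_prod mult_if_0 sum_if_0)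

lemma op23_op12_entry:
  fixes X Y :: "'a::semiring_1^('n::finite \<times> 'n)^('n \<times> 'n)"
  shows "(op23 X ** op12 Y) $ (a, b, c) $ (a', b', c') = (\<Sum>x\<in>UNIV. X $ (b, c) $ (x, c') * Y $ (a, x) $ (a', b'))"
  by (simp add: matrix_matrix_mult_def op12_def op23_def sum_UNIV_prod mult_if_0 sum_if_0)

lemma skew_inverse_entries:
  assumes "skew_inverse R \<Psi>"
  shows "(\<Sum>b\<in>UNIV. \<Sum>y\<in>UNIV. R $ (a, b) $ (a', y) * \<Psi> $ (y, c) $ (b, c')) = (if a = c' \<and> c = a' then 1 else 0)"
    and "(\<Sum>b\<in>UNIV. \<Sum>y\<in>UNIV. \<Psi> $ (a, b) $ (a', y) * R $ (y, c) $ (b, c')) = (if a = c' \<and> c = a' then 1 else 0)"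
proof -
  have "Tr2_of3 (op12 R ** op23 \<Psi>) $ (a, c) $ (a', c') = flip $ (a, c) $ (a', c')"
    "Tr2_of3 (op12 \<Psi> ** op23 R) $ (a, c) $ (a', c') = flip $ (a, c) $ (a', c')"
    using assms by (simp_all add: skew_inverse_def)
  then show "(\<Sum>b\<in>UNIV. \<Sum>y\<in>UNIV. R $ (a, b) $ (a', y) * \<Psi> $ (y, c) $ (b, c')) = (if a = c' \<and> c = a' then 1 else 0)"
    and "(\<Sum>b\<in>UNIV. \<Sum>y\<in>UNIV. \<Psi> $ (a, b) $ (a', y) * R $ (y, c) $ (b, c')) = (if a = c' \<and> c = a' then 1 else 0)"
    by (simp_all add: Tr2_of3_def flip_def op12_op23_entry)
qed

lemma braid_entries:
  assumes "involutive_symmetry R"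
  shows "(\<Sum>x\<in>UNIV. \<Sum>y\<in>UNIV. \<Sum>z\<in>UNIV. R $ (b, c) $ (x, y) * R $ (a, x) $ (a', z) * R $ (z, y) $ (b', c'))
       = (\<Sum>x\<in>UNIV. \<Sum>y\<in>UNIV. \<Sum>z\<in>UNIV. R $ (a, b) $ (x, y) * R $ (y, c) $ (z, c') * R $ (x, z) $ (a', b'))"
proof -
  have "(op23 R ** (op12 R ** op23 R)) $ (a, b, c) $ (a', b', c') = (op12 R ** (op23 R ** op12 R)) $ (a, b, c) $ (a', b', c')"
    using assms by (simp add: involutive_symmetry_def matrix_mul_assoc)
  then show ?thesis
    by (simp only: op23_mult_entry[of R "op12 R ** op23 R"] op12_mult_entry[of R "op23 R ** op12 R"]
        op12_op23_entry op23_op12_entry sum_distrib_left mult.assoc)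
qed

lemma involution_entries:
  assumes "involutive_symmetry R"
  shows "(\<Sum>x\<in>UNIV. \<Sum>y\<in>UNIV. R $ (a, b) $ (x, y) * R $ (x, y) $ (a', b')) = (if a = a' \<and> b = b' then 1 else 0)"
proof -
  have "(R ** R) $ (a, b) $ (a', b') = mat 1 $ (a, b) $ (a', b')"
    using assms by (simp add: involutive_symmetry_def)
  then show ?thesis
    by (simp add: matrix_matrix_mult_def sum_UNIV_prod mat_def)
qed

text \<open>Trace of the first defining identity of \<open>\<Psi>\<close> over the remaining
  position 3: there \<open>\<Psi>\<close> becomes \<open>C = Tr2_of2 \<Psi>\<close>, and the flip
  becomes the identity.\<close>

lemma trace_R_C:
  assumes "skew_inverse R \<Psi>"
  shows "(\<Sum>b\<in>UNIV. \<Sum>y\<in>UNIV. R $ (a, b) $ (a', y) * Tr2_of2 \<Psi> $ y $ b) = (if a = a' then 1 else 0)"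
proof -
  have "(\<Sum>b\<in>UNIV. \<Sum>y\<in>UNIV. R $ (a, b) $ (a', y) * Tr2_of2 \<Psi> $ y $ b)
      = (\<Sum>c\<in>UNIV. \<Sum>b\<in>UNIV. \<Sum>y\<in>UNIV. R $ (a, b) $ (a', y) * \<Psi> $ (y, c) $ (b, c))"
    unfolding Tr2_of2_def 
    by (simp add: sum_distrib_left) (subst sum.swap, rule sum.cong[OF refl], subst sum.swap, rule refl)
  also have "\<dots> = (\<Sum>c\<in>UNIV. if c = a then if c = a' then 1 else 0 else 0)"
    unfolding skew_inverse_entries(1)[OF assms] by (rule sum.cong) auto
  finally show ?thesis by simp
qed

text \<open>
  In matrix form, \<open>Tr\<^sub>2 (C\<^sub>2 R X\<^sub>1 R) = Tr (C X) I\<close> for all \<open>X\<close>. The proof contracts the braid relation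
  \<open>R\<^sub>2 R\<^sub>1 R\<^sub>2 = R\<^sub>1 R\<^sub>2 R\<^sub>1\<close> with \<open>\<Psi>\<close> in the first and with \<open>C\<close> in the third position.
\<close>

lemma trace_R_R_C:
  assumes inv: "involutive_symmetry R" and skew: "skew_inverse R \<Psi>"
  shows "(\<Sum>b\<in>UNIV. \<Sum>y\<in>UNIV. \<Sum>z\<in>UNIV. R $ (a, b) $ (a', y) * R $ (c, y) $ (c', z) * Tr2_of2 \<Psi> $ z $ b)
       = (if a = c' then Tr2_of2 \<Psi> $ c $ a' else 0)"
proof -
  define C where "C = Tr2_of2 \<Psi>"
  define F where "F a b c a' b' c' =
    (\<Sum>x\<in>UNIV. \<Sum>y\<in>UNIV. \<Sum>z\<in>UNIV. R $ (b, c) $ (x, y) * R $ (a, x) $ (a', z) * R $ (z, y) $ (b', c'))"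
    for a b c a' b' c'
  have F: "F a b c a' b' c' =
    (\<Sum>x\<in>UNIV. \<Sum>y\<in>UNIV. \<Sum>z\<in>UNIV. R $ (a, b) $ (x, y) * R $ (y, c) $ (z, c') * R $ (x, z) $ (a', b'))"
    for a b c a' b' c'
    unfolding F_def by (rule braid_entries[OF inv])
  \<comment> \<open>Contraction with \<open>C\<close> in position 3, applied to the form
    \<open>R\<^sub>1 R\<^sub>2 R\<^sub>1\<close>: only the middle factor touches that position,
    \<open>trace_R_C\<close> removes it, and \<open>R\<^sub>1 R\<^sub>1 = I\<close> remains.\<close>
  have 1: "(\<Sum>c\<in>UNIV. \<Sum>c'\<in>UNIV. F a b c a' b' c' * C $ c' $ c) = (if a = a' \<and> b = b' then 1 else 0)" for a b a' b'
  proof -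
    have "(\<Sum>c\<in>UNIV. \<Sum>c'\<in>UNIV. F a b c a' b' c' * C $ c' $ c)
      = (\<Sum>x\<in>UNIV. \<Sum>y\<in>UNIV. \<Sum>z\<in>UNIV.
          R $ (a, b) $ (x, y) * (\<Sum>c\<in>UNIV. \<Sum>c'\<in>UNIV. R $ (y, c) $ (z, c') * C $ c' $ c) * R $ (x, z) $ (a', b'))"
      unfolding F sum_distrib_left sum_distrib_right sum.cartesian_product
      by (rule sum.reindex_bij_witness[where i="\<lambda>(x,y,z,c,c'). (c,c',x,y,z)"
          and j="\<lambda>(c,c',x,y,z). (x,y,z,c,c')"])
        (auto simp: algebra_simps)
    also have "\<dots> = (\<Sum>x\<in>UNIV. \<Sum>y\<in>UNIV. R $ (a, b) $ (x, y) * R $ (x, y) $ (a', b'))"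
      unfolding C_def trace_R_C[OF skew] by (simp add: mult_if_0)
    finally show ?thesis by (simp add: involution_entries[OF inv])
  qed
  \<comment> \<open>Contraction with \<open>\<Psi>\<close> in position 1, applied to the form
    \<open>R\<^sub>2 R\<^sub>1 R\<^sub>2\<close>: the middle factor is cancelled by the second
    skew-inverse identity, which splices the two outer factors together.\<close>
  have 2: "(\<Sum>a\<in>UNIV. \<Sum>a'\<in>UNIV. \<Psi> $ (d, a') $ (d', a) * F a b c a' b' c') = (\<Sum>y\<in>UNIV. R $ (b, c) $ (d', y) * R $ (d, y) $ (b', c'))"
   for b c b' c' d d'
  proof -
    have "(\<Sum>a\<in>UNIV. \<Sum>a'\<in>UNIV. \<Psi> $ (d, a') $ (d', a) * F a b c a' b' c')
      = (\<Sum>x\<in>UNIV. \<Sum>y\<in>UNIV. \<Sum>z\<in>UNIV.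
          R $ (b, c) $ (x, y) * (\<Sum>a'\<in>UNIV. \<Sum>a\<in>UNIV. \<Psi> $ (d, a') $ (d', a) * R $ (a, x) $ (a', z)) * R $ (z, y) $ (b', c'))"
      unfolding F_def sum_distrib_left sum_distrib_right sum.cartesian_product
      by (rule sum.reindex_bij_witness[where i="\<lambda>(x,y,z,a',a). (a,a',x,y,z)"
          and j="\<lambda>(a,a',x,y,z). (x,y,z,a',a)"])
        (auto simp: algebra_simps)
    also have "\<dots> = (\<Sum>x\<in>UNIV. if x = d' then (\<Sum>y\<in>UNIV. R $ (b, c) $ (x, y) * R $ (d, y) $ (b', c')) else 0)"
      unfolding skew_inverse_entries(2)[OF skew]
      by (rule sum.cong) (auto simp: mult_if_0)
    finally show ?thesis by simp
  qed
  have "(\<Sum>b\<in>UNIV. \<Sum>y\<in>UNIV. \<Sum>z\<in>UNIV. R $ (a, b) $ (a', y) * R $ (c, y) $ (c', z) * C $ z $ b)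
     = (\<Sum>b\<in>UNIV. \<Sum>z\<in>UNIV. (\<Sum>y\<in>UNIV. R $ (a, b) $ (a', y) * R $ (c, y) $ (c', z)) * C $ z $ b)"
    unfolding sum_distrib_right by (rule sum.cong[OF refl], rule sum.swap)
  \<comment> \<open>The two contractions concern different positions, so they may be taken in either
    order. Doing the one with \<open>C\<close> first leaves \<open>\<Psi>\<close> contracted with
    the identity, and this is again \<open>C\<close>.\<close>
  also have "\<dots> = (\<Sum>g\<in>UNIV. \<Sum>g'\<in>UNIV. \<Psi> $ (c, g') $ (a', g) * (\<Sum>b\<in>UNIV. \<Sum>z\<in>UNIV. F g a b g' c' z * C $ z $ b))"
    unfolding 2[symmetric] sum_distrib_left sum_distrib_right sum.cartesian_product
    by (rule sum.reindex_bij_witness[where j="\<lambda>(x,y,z,w). (z,w,x,y)" and i="\<lambda>(x,y,z,w). (z,w,x,y)"])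
        (auto simp: algebra_simps)
  also have "\<dots> = (if a = c' then C $ c $ a' else 0)"
    unfolding 1 by (simp add: C_def Tr2_of2_def mult_if_0 if_distrib cong: if_cong)
  finally show ?thesis unfolding C_def .
qed

text \<open>In this lemma and the next, one of the two factors \<open>R\<close> of \<open>trace_R_R_C\<close> is cancelled against \<open>\<Psi>\<close>.\<close>

lemma R_C_eq_C_Psi:
  assumes inv: "involutive_symmetry R" and skew: "skew_inverse R \<Psi>"
  shows "(\<Sum>z\<in>UNIV. R $ (c, e) $ (c', z) * Tr2_of2 \<Psi> $ z $ e') = (\<Sum>z\<in>UNIV. Tr2_of2 \<Psi> $ c $ z * \<Psi> $ (e, z) $ (e', c'))"
proof -
  define C where "C = Tr2_of2 \<Psi>"
  have "(\<Sum>a\<in>UNIV. \<Sum>z\<in>UNIV. \<Psi> $ (e, z) $ (e', a) * (if a = c' then C $ c $ z else 0))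
     = (\<Sum>a\<in>UNIV. \<Sum>a'\<in>UNIV. \<Psi> $ (e, a') $ (e', a) *
        (\<Sum>b\<in>UNIV. \<Sum>y\<in>UNIV. \<Sum>z\<in>UNIV. R $ (a, b) $ (a', y) * R $ (c, y) $ (c', z) * C $ z $ b))"
    unfolding C_def trace_R_R_C[OF inv skew] ..
  also have "\<dots> = (\<Sum>b\<in>UNIV. \<Sum>y\<in>UNIV. \<Sum>z\<in>UNIV.
        (\<Sum>a'\<in>UNIV. \<Sum>a\<in>UNIV. \<Psi> $ (e, a') $ (e', a) * R $ (a, b) $ (a', y)) * R $ (c, y) $ (c', z) * C $ z $ b)"
      unfolding sum_distrib_left sum_distrib_right sum.cartesian_product
      by (rule sum.reindex_bij_witness[where i="\<lambda>(x,y,z,a',a). (a,a',x,y,z)"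
          and j="\<lambda>(a,a',x,y,z). (x,y,z,a',a)"])
        (auto simp: algebra_simps)
  also have "\<dots> = (\<Sum>b\<in>UNIV. if b = e' then (\<Sum>z\<in>UNIV. R $ (c, e) $ (c', z) * C $ z $ b) else 0)"
    unfolding skew_inverse_entries(2)[OF skew]
    by (rule sum.cong[OF refl], subst sum.swap) (auto simp: mult_if_0)
  finally show ?thesis
    unfolding C_def
    by (simp add: mult_if_0 if_distrib sum.swap[where A=UNIV and B=UNIV, of "\<lambda>a z. if a = c' then _ a z else 0"]
        mult.commute cong: if_cong)
qed

lemma C_R_eq_Psi_C:
  assumes inv: "involutive_symmetry R" and skew: "skew_inverse R \<Psi>"
  shows "(\<Sum>b\<in>UNIV. Tr2_of2 \<Psi> $ e $ b * R $ (a, b) $ (a', e')) = (\<Sum>z\<in>UNIV. \<Psi> $ (e, a) $ (e', z) * Tr2_of2 \<Psi> $ z $ a')"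
proof -
  define C where "C = Tr2_of2 \<Psi>"
  have "(\<Sum>c\<in>UNIV. \<Sum>c'\<in>UNIV. \<Psi> $ (e, c') $ (e', c) * (if a = c' then C $ c $ a' else 0))
     = (\<Sum>c\<in>UNIV. \<Sum>c'\<in>UNIV. \<Psi> $ (e, c') $ (e', c) *
        (\<Sum>b\<in>UNIV. \<Sum>y\<in>UNIV. \<Sum>z\<in>UNIV. R $ (a, b) $ (a', y) * R $ (c, y) $ (c', z) * C $ z $ b))"
    unfolding C_def trace_R_R_C[OF inv skew] ..
  also have "\<dots> = (\<Sum>b\<in>UNIV. \<Sum>y\<in>UNIV. \<Sum>z\<in>UNIV.
        (\<Sum>c'\<in>UNIV. \<Sum>c\<in>UNIV. \<Psi> $ (e, c') $ (e', c) * R $ (c, y) $ (c', z)) * R $ (a, b) $ (a', y) * C $ z $ b)"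
      unfolding sum_distrib_left sum_distrib_right sum.cartesian_product
      by (rule sum.reindex_bij_witness[where i="\<lambda>(x,y,z,a',a). (a,a',x,y,z)"
          and j="\<lambda>(a,a',x,y,z). (x,y,z,a',a)"])
        (auto simp: algebra_simps)
  also have "\<dots> = (\<Sum>b\<in>UNIV. R $ (a, b) $ (a', e') * C $ e $ b)"
    unfolding skew_inverse_entries(2)[OF skew]
  proof (rule sum.cong[OF refl])
    fix b
    have "(\<Sum>y\<in>UNIV. \<Sum>z\<in>UNIV. (if e = z \<and> y = e' then 1 else 0) * R $ (a, b) $ (a', y) * C $ z $ b)
      = (\<Sum>y\<in>UNIV. if y = e' then R $ (a, b) $ (a', y) * C $ e $ b else 0)"
      by (rule sum.cong) (auto simp: mult_if_0)
    then show "(\<Sum>y\<in>UNIV. \<Sum>z\<in>UNIV. (if e = z \<and> y = e' then 1 else 0) * R $ (a, b) $ (a', y) * C $ z $ b)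
      = R $ (a, b) $ (a', e') * C $ e $ b"
      by simp
  qed
  finally show ?thesis
    unfolding C_def
    by (simp add: mult_if_0 if_distrib mult.commute cong: if_cong)
qed

definition tensor_square :: "'a::times^'n::finite^'n \<Rightarrow> 'a^('n \<times> 'n)^('n \<times> 'n)" where
  "tensor_square X = (\<chi> p q. X $ fst p $ fst q * X $ snd p $ snd q)"

text \<open>The two factors \<open>C\<close> pass \<open>R\<close> one at a time:
  \<open>R_C_eq_C_Psi\<close> brings one to the left and turns \<open>R\<close> into
  \<open>\<Psi>\<close>; \<open>C_R_eq_Psi_C\<close> brings over the other and turns
  \<open>\<Psi>\<close> back into \<open>R\<close>.\<close>

lemma R_commutes_tensor_square:
  assumes inv: "involutive_symmetry R" and skew: "skew_inverse R \<Psi>"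
  shows "R ** tensor_square (Tr2_of2 \<Psi>) = tensor_square (Tr2_of2 \<Psi>) ** R"
proof -
  define C where "C = Tr2_of2 \<Psi>"
  have "(R ** tensor_square C) $ (c, e) $ (c', e') = (tensor_square C ** R) $ (c, e) $ (c', e')" for c e c' e'
  proof -
    have "(R ** tensor_square C) $ (c, e) $ (c', e') = (\<Sum>w\<in>UNIV. (\<Sum>z\<in>UNIV. R $ (c, e) $ (w, z) * C $ z $ e') * C $ w $ c')"
      by (simp add: matrix_matrix_mult_def tensor_square_def sum_UNIV_prod sum_distrib_left sum_distrib_right mult_ac)
    also have "\<dots> = (\<Sum>w\<in>UNIV. (\<Sum>z\<in>UNIV. C $ c $ z * \<Psi> $ (e, z) $ (e', w)) * C $ w $ c')"
      unfolding C_def R_C_eq_C_Psi[OF inv skew] ..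
    also have "\<dots> = (\<Sum>z\<in>UNIV. C $ c $ z * (\<Sum>w\<in>UNIV. \<Psi> $ (e, z) $ (e', w) * C $ w $ c'))"
      unfolding sum_distrib_right sum_distrib_left by (subst sum.swap) (simp add: mult.assoc)
    also have "\<dots> = (\<Sum>z\<in>UNIV. C $ c $ z * (\<Sum>b\<in>UNIV. C $ e $ b * R $ (z, b) $ (c', e')))"
      unfolding C_def C_R_eq_Psi_C[OF inv skew] ..
    also have "\<dots> = (tensor_square C ** R) $ (c, e) $ (c', e')"
      by (simp add: matrix_matrix_mult_def tensor_square_def sum_UNIV_prod sum_distrib_left algebra_simps)
    finally show ?thesis .
  qed
  then show ?thesis unfolding C_def by (auto simp: vec_eq_iff)
qed


section \<open>\<open>R\<close>-traces over the free algebra\<close>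

text \<open>A scalar is supported at the empty word, the unit of the monoid of words, so it commutes
  with every monomial. The induction adds one monomial at a time.\<close>

lemma scalar_commute: "scalar c * x = x * (scalar c :: ('k, 'n) free_alg)"
proof (induction x rule: update_induct)
  case const
  show ?case by (simp add: zero_poly_mapping.abs_eq[symmetric])
next
  case (update f a b)
  have "Poly_Mapping.update a b f = f + Poly_Mapping.single a b"
    using update(1) by (intro poly_mapping_eqI) (auto simp: lookup_update lookup_add lookup_single when_def in_keys_iff)
  then show ?case
    using update(3) by (simp add: distrib_left distrib_right scalar_def mult_single mult.commute)
qed

lemma scalar_mult: "scalar (a * b) = (scalar a * scalar b :: ('k, 'n) free_alg)"
  by (simp add: scalar_def mult_single)

lemma scalar_zero [simp]: "scalar 0 = 0"
  by (simp add: scalar_def)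

lemma scalar_one [simp]: "scalar 1 = 1"
  by (simp add: scalar_def)

lemma scalar_add: "scalar (a + b) = scalar a + scalar b"
  by (simp add: scalar_def single_add)

lemma scalar_sum: "scalar (sum f A) = (\<Sum>x\<in>A. scalar (f x))"
  by (induction A rule: infinite_finite_induct) (simp_all add: scalar_add)

lemma scalar_mat_mult: "scalar_mat (A ** B) = scalar_mat A ** scalar_mat B"
  by (simp add: scalar_mat_def matrix_matrix_mult_def vec_eq_iff scalar_sum scalar_mult)

lemma scalar_mat_one [simp]: "scalar_mat (mat 1) = mat 1"
  by (simp add: scalar_mat_def mat_def vec_eq_iff)

text \<open>Over a noncommutative ring the trace is not cyclic in general; it is when one of the two
  matrices has central entries.\<close>

lemma trace_scalar_mat_commute: "trace (scalar_mat A ** X) = trace (X ** scalar_mat A)"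
  unfolding trace_def matrix_matrix_mult_def
  by (simp add: scalar_mat_def) (subst sum.swap, simp add: scalar_commute)

section \<open>R-traces in two tensor positions\<close>

lemma leg1_mult_entry:
  fixes X :: "'a::semiring_1^'n::finite^'n"
  shows "(leg1 X ** Z) $ (a, b) $ q = (\<Sum>c\<in>UNIV. X $ a $ c * Z $ (c, b) $ q)"
  by (simp add: matrix_matrix_mult_def leg1_def sum_UNIV_prod mult_if_0 sum_if_0)

lemma mult_leg1_entry:
  fixes X :: "'a::semiring_1^'n::finite^'n"
  shows "(Z ** leg1 X) $ p $ (a, b) = (\<Sum>c\<in>UNIV. Z $ p $ (c, b) * X $ c $ a)"
  by (simp add: matrix_matrix_mult_def leg1_def sum_UNIV_prod mult_if_0 sum_if_0)

lemma leg1_mult: "leg1 (X ** Y) = leg1 X ** leg1 (Y :: 'a::semiring_1^'n::finite^'n)"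
  by (simp add: vec_eq_iff leg1_mult_entry) (simp add: leg1_def matrix_matrix_mult_def)

definition R_trace2 :: "complex^('n::finite \<times> 'n)^('n \<times> 'n) \<Rightarrow>
    ('k, 'n) free_alg^('n \<times> 'n)^('n \<times> 'n) \<Rightarrow> ('k, 'n) free_alg" where
  "R_trace2 \<Psi> X = trace (scalar_mat (tensor_square (Tr2_of2 \<Psi>)) ** X)"

lemma R_trace2_entries:
  "R_trace2 \<Psi> X = (\<Sum>a\<in>UNIV. \<Sum>b\<in>UNIV. \<Sum>c\<in>UNIV. \<Sum>d\<in>UNIV.
     scalar (Tr2_of2 \<Psi> $ a $ c) * (scalar (Tr2_of2 \<Psi> $ b $ d) * X $ (c, d) $ (a, b)))"
  by (simp add: R_trace2_def trace_def matrix_matrix_mult_def sum_UNIV_prod scalar_mat_def tensor_square_def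
      scalar_mult mult.assoc)

lemma R_trace_entries:
  "R_trace \<Psi> X = (\<Sum>a\<in>UNIV. \<Sum>c\<in>UNIV. scalar (Tr2_of2 \<Psi> $ a $ c) * X $ c $ a)"
  by (simp add: R_trace_def trace_def matrix_matrix_mult_def scalar_mat_def)

lemma R_trace2_cyclic:
  assumes "involutive_symmetry R" and "skew_inverse R \<Psi>"
  shows "R_trace2 \<Psi> (scalar_mat R ** X) = R_trace2 \<Psi> (X ** scalar_mat R)"
proof -
  let ?C = "tensor_square (Tr2_of2 \<Psi>)"
  have "R_trace2 \<Psi> (scalar_mat R ** X) = trace (scalar_mat (?C ** R) ** X)"
    by (simp add: R_trace2_def scalar_mat_mult matrix_mul_assoc)
  also have "\<dots> = trace (scalar_mat R ** (scalar_mat ?C ** X))"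
    by (simp add: R_commutes_tensor_square[OF assms, symmetric] scalar_mat_mult matrix_mul_assoc)
  also have "\<dots> = trace ((scalar_mat ?C ** X) ** scalar_mat R)"
    by (rule trace_scalar_mat_commute)
  also have "\<dots> = R_trace2 \<Psi> (X ** scalar_mat R)"
    by (simp add: R_trace2_def matrix_mul_assoc)
  finally show ?thesis .
qed

lemma scalar_left_commute: "x * (scalar c * y) = scalar c * (x * (y :: ('k, 'n) free_alg))"
  by (metis mult.assoc scalar_commute)

text \<open>Gathers the coefficients from \<open>R\<close> and \<open>C\<close> into one scalar, in
  the order of \<open>trace_R_C\<close> and \<open>trace_R_R_C\<close>, while \<open>x\<close> and
  \<open>y\<close> keep their order.\<close>

lemma scalar_collect:
  fixes x y :: "('k, 'n) free_alg"
  shows "scalar p * (scalar q * (x * (scalar r * y))) = scalar p * (x * (scalar (r * q) * y))"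
    and "scalar p * (scalar q * (x * (scalar r * (y * scalar s)))) = scalar p * (x * (scalar (r * s * q) * y))"
proof -
  have *: "scalar q * (x * z) = x * (scalar q * z)" for z
    by (rule scalar_left_commute[symmetric])
  show "scalar p * (scalar q * (x * (scalar r * y))) = scalar p * (x * (scalar (r * q) * y))"
    unfolding * scalar_mult[of r] scalar_commute[of r "scalar q"] mult.assoc ..
  show "scalar p * (scalar q * (x * (scalar r * (y * scalar s)))) = scalar p * (x * (scalar (r * s * q) * y))"
    unfolding * scalar_commute[of s y, symmetric] scalar_mult mult.assoc
    unfolding mult.assoc[symmetric] scalar_mult[symmetric] by (simp add: mult_ac)
qed

text \<open>Position 2 is seen only by \<open>R\<close> and \<open>C\<^sub>2\<close>. Once its
  indices are summed innermost, \<open>trace_R_C\<close> replaces them by the identity, leaving the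
  trace of \<open>C X Y\<close>.\<close>

lemma R_trace2_leg1_R_leg1:
  fixes X Y :: "('k, 'n::finite) free_alg^'n^'n"
  assumes skew: "skew_inverse R \<Psi>"
  shows "R_trace2 \<Psi> (leg1 X ** scalar_mat R ** leg1 Y) = R_trace \<Psi> (X ** Y)"
proof -
  define C where "C = Tr2_of2 \<Psi>"
  have "R_trace2 \<Psi> (leg1 X ** scalar_mat R ** leg1 Y) =
    (\<Sum>a\<in>UNIV. \<Sum>b\<in>UNIV. \<Sum>c\<in>UNIV. \<Sum>d\<in>UNIV. \<Sum>e\<in>UNIV. \<Sum>f\<in>UNIV.
       scalar (C $ a $ c) * (scalar (C $ b $ d) * (X $ c $ e * (scalar (R $ (e, d) $ (f, b)) * Y $ f $ a))))"
    unfolding R_trace2_entries C_def[symmetric] matrix_mul_assoc[symmetric] leg1_mult_entry mult_leg1_entry sum_distrib_left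
    by (simp add: scalar_mat_def)
  also have "\<dots> = (\<Sum>a\<in>UNIV. \<Sum>c\<in>UNIV. \<Sum>e\<in>UNIV. \<Sum>f\<in>UNIV. \<Sum>d\<in>UNIV. \<Sum>b\<in>UNIV.
       scalar (C $ a $ c) * (X $ c $ e * (scalar (R $ (e, d) $ (f, b) * C $ b $ d) * Y $ f $ a)))"
    unfolding sum.cartesian_product
    by (rule sum.reindex_bij_witness[where i="\<lambda>(a,c,e,f,d,b). (a,b,c,d,e,f)"
          and j="\<lambda>(a,b,c,d,e,f). (a,c,e,f,d,b)"])
      (auto simp: scalar_collect(1))
  also have "\<dots> = (\<Sum>a\<in>UNIV. \<Sum>c\<in>UNIV. \<Sum>e\<in>UNIV. \<Sum>f\<in>UNIV.
       scalar (C $ a $ c) * (X $ c $ e * (scalar (if e = f then 1 else 0) * Y $ f $ a)))"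
    unfolding C_def trace_R_C[OF skew, symmetric] scalar_sum sum_distrib_left sum_distrib_right ..
  also have "\<dots> = R_trace \<Psi> (X ** Y)"
    by (simp add: R_trace_entries C_def matrix_matrix_mult_def sum_distrib_left if_distrib[of scalar] mult_if_0 cong: if_cong)
  finally show ?thesis .
qed

text \<open>\<open>trace_R_R_C\<close> holds for each pair of indices of the matrix placed between
  the two factors \<open>R\<close>, so it applies coefficientwise to \<open>Y\<close>. Entries of
  \<open>X\<close> stay to the left of those of \<open>Y\<close>, which fixes the order of the
  product.\<close>

lemma R_trace2_leg1_R_leg1_R:
  fixes X Y :: "('k, 'n::finite) free_alg^'n^'n"
  assumes inv: "involutive_symmetry R" and skew: "skew_inverse R \<Psi>"
  shows "R_trace2 \<Psi> (leg1 X ** (scalar_mat R ** leg1 Y ** scalar_mat R)) = R_trace \<Psi> X * R_trace \<Psi> Y"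
proof -
  define C where "C = Tr2_of2 \<Psi>"
  have entry: "(scalar_mat R ** (leg1 Y ** scalar_mat R)) $ (e, d) $ (a, b) = (\<Sum>f\<in>UNIV. \<Sum>g\<in>UNIV.
      scalar (R $ (e, d) $ (f, g)) * (\<Sum>h\<in>UNIV. Y $ f $ h * scalar (R $ (h, g) $ (a, b))))" for e d a b
    unfolding matrix_matrix_mult_def[of "scalar_mat R"]
    by (simp add: sum_UNIV_prod leg1_mult_entry) (simp add: scalar_mat_def)
  have "R_trace2 \<Psi> (leg1 X ** (scalar_mat R ** leg1 Y ** scalar_mat R)) =
    (\<Sum>a\<in>UNIV. \<Sum>b\<in>UNIV. \<Sum>c\<in>UNIV. \<Sum>d\<in>UNIV. \<Sum>e\<in>UNIV. \<Sum>f\<in>UNIV. \<Sum>g\<in>UNIV. \<Sum>h\<in>UNIV.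
       scalar (C $ a $ c) * (scalar (C $ b $ d) * (X $ c $ e *
         (scalar (R $ (e, d) $ (f, g)) * (Y $ f $ h * scalar (R $ (h, g) $ (a, b)))))))"
    unfolding R_trace2_entries C_def[symmetric] matrix_mul_assoc[symmetric] leg1_mult_entry entry sum_distrib_left ..
  also have "\<dots> =
    (\<Sum>a\<in>UNIV. \<Sum>c\<in>UNIV. \<Sum>e\<in>UNIV. \<Sum>h\<in>UNIV. \<Sum>f\<in>UNIV. \<Sum>d\<in>UNIV. \<Sum>g\<in>UNIV. \<Sum>b\<in>UNIV.
       scalar (C $ a $ c) * (X $ c $ e * (scalar (R $ (e, d) $ (f, g) * R $ (h, g) $ (a, b) * C $ b $ d) * Y $ f $ h)))"
    unfolding sum.cartesian_product
    by (rule sum.reindex_bij_witness[where i="\<lambda>(a,c,e,h,f,d,g,b). (a,b,c,d,e,f,g,h)"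
          and j="\<lambda>(a,b,c,d,e,f,g,h). (a,c,e,h,f,d,g,b)"])
      (auto simp: scalar_collect(2))
  also have "\<dots> = (\<Sum>a\<in>UNIV. \<Sum>c\<in>UNIV. \<Sum>e\<in>UNIV. \<Sum>h\<in>UNIV. \<Sum>f\<in>UNIV.
       scalar (C $ a $ c) * (X $ c $ e * (scalar (if e = a then C $ h $ f else 0) * Y $ f $ h)))"
    unfolding C_def trace_R_R_C[OF inv skew, symmetric] scalar_sum sum_distrib_left sum_distrib_right ..
  also have "\<dots> = (\<Sum>a\<in>UNIV. \<Sum>c\<in>UNIV. \<Sum>e\<in>UNIV. if e = a then \<Sum>h\<in>UNIV. \<Sum>f\<in>UNIV.
       scalar (C $ a $ c) * (X $ c $ e * (scalar (C $ h $ f) * Y $ f $ h)) else 0)"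
    by (intro sum.cong refl) auto
  also have "\<dots> = R_trace \<Psi> X * R_trace \<Psi> Y"
    unfolding R_trace_entries C_def sum_distrib_right unfolding sum_distrib_left by (simp add: mult.assoc)
  finally show ?thesis .
qed


section \<open>Congruence modulo a two-sided ideal\<close>

lemma matrix_add_rdistrib: "(A + B) ** C = A ** C + B ** (C :: 'a::semiring_1^'n^'m)"
  by (simp add: matrix_matrix_mult_def vec_eq_iff distrib_right sum.distrib)

lemma matrix_diff_rdistrib: "(A - B) ** C = A ** C - B ** (C :: 'a::ring_1^'n^'m)"
  by (simp add: matrix_matrix_mult_def vec_eq_iff left_diff_distrib sum_subtractf)

lemma matrix_diff_ldistrib: "C ** (A - B) = C ** A - C ** (B :: 'a::ring_1^'n^'m)"
  by (simp add: matrix_matrix_mult_def vec_eq_iff right_diff_distrib sum_subtractf)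

lemma free_ring_is_ring: "ring (free_ring :: ('k, 'n) free_alg ring)"
proof (rule ringI)
  show "abelian_group (free_ring :: ('k, 'n) free_alg ring)"
    by (rule abelian_groupI) (auto simp: free_ring_def algebra_simps intro: exI[of _ "- _"] left_minus)
  show "monoid (free_ring :: ('k, 'n) free_alg ring)"
    by (rule monoidI) (auto simp: free_ring_def mult.assoc)
qed (auto simp: free_ring_def algebra_simps)

lemma free_ring_simps [simp]:
  "carrier free_ring = UNIV" "x \<otimes>\<^bsub>free_ring\<^esub> y = x * y" "x \<oplus>\<^bsub>free_ring\<^esub> y = x + y"
  "\<zero>\<^bsub>free_ring\<^esub> = 0"
  by (simp_all add: free_ring_def)

lemma free_ring_a_inv [simp]: "\<ominus>\<^bsub>free_ring\<^esub> x = - (x :: ('k, 'n) free_alg)"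
proof -
  interpret ring "free_ring :: ('k, 'n) free_alg ring" by (rule free_ring_is_ring)
  show ?thesis by (rule minus_equality) simp_all
qed

lemma ideal_rel_ideal: "ideal (rel_ideal R) (free_ring :: ('k, 'n::finite) free_alg ring)"
  unfolding rel_ideal_def by (rule ring.genideal_ideal[OF free_ring_is_ring]) simp

lemma relators_subset_rel_ideal: "relators R \<subseteq> rel_ideal R"
  unfolding rel_ideal_def by (rule ring.genideal_self[OF free_ring_is_ring]) simp

lemma to_alg_eq_iff: "to_alg R x = to_alg R y \<longleftrightarrow> x - y \<in> rel_ideal R"
proof -
  interpret I: ideal "rel_ideal R" "free_ring :: ('a, 'b) free_alg ring" by (rule ideal_rel_ideal)
  show ?thesis
    using I.quotient_eq_iff_same_a_r_cos[OF ideal_rel_ideal, of x y] unfolding to_alg_def a_minus_def by simp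
qed

lemma to_alg_mult: "to_alg R x \<otimes>\<^bsub>gaudin_alg R\<^esub> to_alg R y = to_alg R (x * y)"
proof -
  interpret I: ideal "rel_ideal R" "free_ring :: ('a, 'b) free_alg ring" by (rule ideal_rel_ideal)
  show ?thesis
    using I.rcoset_mult_add[of x y] unfolding to_alg_def gaudin_alg_def FactRing_def by simp
qed

text \<open>Relations of the quotient are handled as congruences between elements of the free
  algebra, so that sums, matrix products and traces can be formed before passing to cosets.\<close>

locale two_sided_ideal =
  fixes I :: "'a::ring_1 set"
  assumes zero_mem: "0 \<in> I"
    and diff_mem: "x \<in> I \<Longrightarrow> y \<in> I \<Longrightarrow> x - y \<in> I"
    and lmult_mem: "x \<in> I \<Longrightarrow> r * x \<in> I"
    and rmult_mem: "x \<in> I \<Longrightarrow> x * r \<in> I"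
begin

definition eqv :: "'a \<Rightarrow> 'a \<Rightarrow> bool" (infix \<open>\<doteq>\<close> 50) where
  "x \<doteq> y \<longleftrightarrow> x - y \<in> I"

lemma minus_mem: "x \<in> I \<Longrightarrow> - x \<in> I"
  using diff_mem[OF zero_mem, of x] by simp

lemma add_mem: "x \<in> I \<Longrightarrow> y \<in> I \<Longrightarrow> x + y \<in> I"
  using diff_mem[of x "- y"] minus_mem by simp

lemma sum_mem: "(\<And>x. x \<in> A \<Longrightarrow> f x \<in> I) \<Longrightarrow> sum f A \<in> I"
  by (induction A rule: infinite_finite_induct) (auto simp: zero_mem add_mem)

lemma eqv_refl [simp]: "x \<doteq> x"
  by (simp add: eqv_def zero_mem)

lemma eqv_sym: "x \<doteq> y \<Longrightarrow> y \<doteq> x"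
  using minus_mem[of "x - y"] by (simp add: eqv_def)

lemma eqv_trans [trans]: "x \<doteq> y \<Longrightarrow> y \<doteq> z \<Longrightarrow> x \<doteq> z"
  using add_mem[of "x - y" "y - z"] by (simp add: eqv_def)

lemma eqv_add: "x \<doteq> x' \<Longrightarrow> y \<doteq> y' \<Longrightarrow> x + y \<doteq> x' + y'"
  using add_mem[of "x - x'" "y - y'"] by (simp add: eqv_def algebra_simps)

lemma eqv_diff: "x \<doteq> x' \<Longrightarrow> y \<doteq> y' \<Longrightarrow> x - y \<doteq> x' - y'"
  using diff_mem[of "x - x'" "y - y'"] by (simp add: eqv_def algebra_simps)

lemma eqv_mult: "x \<doteq> x' \<Longrightarrow> y \<doteq> y' \<Longrightarrow> x * y \<doteq> x' * y'"
  using add_mem[OF rmult_mem[of "x - x'" y] lmult_mem[of "y - y'" x']] by (simp add: eqv_def algebra_simps)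

lemma eqv_sum: "(\<And>x. x \<in> A \<Longrightarrow> f x \<doteq> g x) \<Longrightarrow> sum f A \<doteq> sum g A"
  using sum_mem[of A "\<lambda>x. f x - g x"] by (simp add: eqv_def sum_subtractf)

definition mat_eqv :: "'a^'m^'n \<Rightarrow> 'a^'m^'n \<Rightarrow> bool" (infix \<open>\<doteq>\<^sub>m\<close> 50) where
  "X \<doteq>\<^sub>m Y \<longleftrightarrow> (\<forall>i j. X $ i $ j \<doteq> Y $ i $ j)"

lemma mat_eqv_refl [simp]: "X \<doteq>\<^sub>m X"
  by (simp add: mat_eqv_def)

lemma mat_eqv_trans [trans]: "X \<doteq>\<^sub>m Y \<Longrightarrow> Y \<doteq>\<^sub>m Z \<Longrightarrow> X \<doteq>\<^sub>m Z"
  unfolding mat_eqv_def using eqv_trans by blast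

lemma mat_eqv_add: "X \<doteq>\<^sub>m X' \<Longrightarrow> Y \<doteq>\<^sub>m Y' \<Longrightarrow> X + Y \<doteq>\<^sub>m X' + Y'"
  by (auto simp: mat_eqv_def intro: eqv_add)

lemma mat_eqv_mult: "X \<doteq>\<^sub>m X' \<Longrightarrow> Y \<doteq>\<^sub>m Y' \<Longrightarrow> X ** Y \<doteq>\<^sub>m X' ** Y'"
  by (auto simp: mat_eqv_def matrix_matrix_mult_def intro!: eqv_sum eqv_mult)

lemma trace_eqv: "X \<doteq>\<^sub>m Y \<Longrightarrow> trace X \<doteq> trace Y"
  by (auto simp: mat_eqv_def trace_def intro: eqv_sum)

text \<open>Unprimed matrices stand for first and primed ones for second overlined copies.
  \<open>X'\<close> and then \<open>Z'\<close> are moved to the left; only the exchange of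
  \<open>X\<close> and \<open>X'\<close> costs a correction, and it arises at the far left.\<close>

lemma commutator_shared_left:
  assumes "Y ** X' \<doteq>\<^sub>m X' ** Y" "X ** Z' \<doteq>\<^sub>m Z' ** X" "Y ** Z' \<doteq>\<^sub>m Z' ** Y"
    and "X ** X' \<doteq>\<^sub>m X' ** X + D"
  shows "X ** Y ** (X' ** Z') \<doteq>\<^sub>m X' ** Z' ** (X ** Y) + D ** Y ** Z'"
proof -
  have "X ** Y ** (X' ** Z') = X ** (Y ** X') ** Z'"
    by (simp add: matrix_mul_assoc)
  also have "\<dots> \<doteq>\<^sub>m X ** (X' ** Y) ** Z'"
    by (intro mat_eqv_mult mat_eqv_refl assms)
  also have "\<dots> = X ** X' ** (Y ** Z')"
    by (simp add: matrix_mul_assoc)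
  also have "\<dots> \<doteq>\<^sub>m (X' ** X + D) ** (Y ** Z')"
    by (intro mat_eqv_mult mat_eqv_refl assms)
  also have "\<dots> = X' ** X ** (Y ** Z') + D ** Y ** Z'"
    by (simp add: matrix_add_rdistrib matrix_mul_assoc)
  also have "\<dots> \<doteq>\<^sub>m X' ** X ** (Z' ** Y) + D ** Y ** Z'"
    by (intro mat_eqv_add mat_eqv_mult mat_eqv_refl assms)
  also have "\<dots> = X' ** (X ** Z') ** Y + D ** Y ** Z'"
    by (simp add: matrix_mul_assoc)
  also have "\<dots> \<doteq>\<^sub>m X' ** (Z' ** X) ** Y + D ** Y ** Z'"
    by (intro mat_eqv_add mat_eqv_mult mat_eqv_refl assms)
  finally show ?thesis
    by (simp add: matrix_mul_assoc)
qed

text \<open>Now the exchange with a correction is that of the adjacent inner factors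
  \<open>Y\<close> and \<open>Y'\<close>, so \<open>D\<close> stays between \<open>X\<close> and
  \<open>Z'\<close>.\<close>

lemma commutator_shared_right:
  assumes "X ** Y' \<doteq>\<^sub>m Y' ** X" "X ** Z' \<doteq>\<^sub>m Z' ** X" "Y ** Z' \<doteq>\<^sub>m Z' ** Y"
    and "Y ** Y' \<doteq>\<^sub>m Y' ** Y + D"
  shows "X ** Y ** (Y' ** Z') \<doteq>\<^sub>m Y' ** Z' ** (X ** Y) + X ** D ** Z'"
proof -
  have "X ** Y ** (Y' ** Z') = X ** (Y ** Y') ** Z'"
    by (simp add: matrix_mul_assoc)
  also have "\<dots> \<doteq>\<^sub>m X ** (Y' ** Y + D) ** Z'"
    by (intro mat_eqv_mult mat_eqv_refl assms)
  also have "\<dots> = X ** Y' ** (Y ** Z') + X ** D ** Z'"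
    by (simp add: matrix_add_rdistrib matrix_add_ldistrib matrix_mul_assoc)
  also have "\<dots> \<doteq>\<^sub>m Y' ** X ** (Z' ** Y) + X ** D ** Z'"
    by (intro mat_eqv_add mat_eqv_mult mat_eqv_refl assms)
  also have "\<dots> = Y' ** (X ** Z') ** Y + X ** D ** Z'"
    by (simp add: matrix_mul_assoc)
  also have "\<dots> \<doteq>\<^sub>m Y' ** (Z' ** X) ** Y + X ** D ** Z'"
    by (intro mat_eqv_add mat_eqv_mult mat_eqv_refl assms)
  finally show ?thesis
    by (simp add: matrix_mul_assoc)
qed

end

lemma two_sided_ideal_rel_ideal: "two_sided_ideal (rel_ideal R :: ('k, 'n::finite) free_alg set)"
proof -
  interpret I: ideal "rel_ideal R" "free_ring :: ('k, 'n) free_alg ring" by (rule ideal_rel_ideal)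
  show ?thesis
  proof
    fix x y r :: "('k, 'n) free_alg"
    show "(0 :: ('k, 'n) free_alg) \<in> rel_ideal R" using additive_subgroup.zero_closed[OF I.is_additive_subgroup] by simp
    show "r * x \<in> rel_ideal R" "x * r \<in> rel_ideal R" if "x \<in> rel_ideal R"
      using I.I_l_closed[OF that, of r] I.I_r_closed[OF that, of r] by simp_all
    show "x - y \<in> rel_ideal R" if "x \<in> rel_ideal R" "y \<in> rel_ideal R"
      using additive_subgroup.a_closed[OF I.is_additive_subgroup that(1) I.I_l_closed[OF that(2), of "-1"]] by simp
  qed
qed

lemma R_trace2_add: "R_trace2 \<Psi> (X + Y) = R_trace2 \<Psi> X + R_trace2 \<Psi> Y"
  by (simp add: R_trace2_def matrix_add_ldistrib trace_def sum.distrib)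

lemma R_trace2_diff: "R_trace2 \<Psi> (X - Y) = R_trace2 \<Psi> X - R_trace2 \<Psi> Y"
  by (simp add: R_trace2_def matrix_diff_ldistrib trace_def sum_subtractf)


section \<open>Infinitesimal braid relations\<close>

text \<open>\<open>I\<close> is any two-sided ideal containing the relators; the final proof takes
  \<open>rel_ideal R\<close>.\<close>

locale gaudin = two_sided_ideal I
  for I :: "('k, 'n::finite) free_alg set" +
  fixes R \<Psi> :: "complex^('n \<times> 'n)^('n \<times> 'n)"
  assumes inv: "involutive_symmetry R"
    and skew: "skew_inverse R \<Psi>"
    and relators: "relators R \<subseteq> I"
begin

text \<open>Fixes the type of the matrices \<open>M(k)\<close>, which \<open>Mgen\<close> leaves open in \<open>'n\<close>.\<close>

abbreviation gen :: "'k \<Rightarrow> ('k, 'n) free_alg^'n^'n" where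
  "gen \<equiv> Mgen"

abbreviation RA :: "('k, 'n) free_alg^('n \<times> 'n)^('n \<times> 'n)" where
  "RA \<equiv> scalar_mat R"

definition \<Omega> :: "'k \<Rightarrow> 'k \<Rightarrow> ('k, 'n) free_alg" where
  "\<Omega> k l = R_trace \<Psi> (gen k ** gen l)"

section \<open>Overlined matrices: their relations and the traces of their products\<close>

lemma R_square: "R ** R = mat 1"
  using inv by (simp add: involutive_symmetry_def)

lemma RA_square [simp]: "RA ** RA = mat 1"
  by (simp add: scalar_mat_mult[symmetric] R_square)

lemma RA_square_right [simp]: "X ** RA ** RA = X"
  by (simp add: matrix_mul_assoc[symmetric])

text \<open>\<open>R\<close> is its own inverse because it is an involution, and
  \<open>matrix_inv\<close> chooses it because a two-sided inverse is unique.\<close>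

lemma over2_eq: "over2 R X = scalar_mat R ** leg1 X ** scalar_mat R"
proof -
  have "matrix_inv R = R"
    unfolding matrix_inv_def
  proof (rule some_equality)
    show "B = R" if B: "R ** B = mat 1 \<and> B ** R = mat 1" for B
    proof -
      have "B = B ** (R ** R)" by (simp add: R_square)
      also have "\<dots> = R" by (simp add: B matrix_mul_assoc)
      finally show ?thesis .
    qed
  qed (simp add: R_square)
  then show ?thesis by (simp add: over2_def over1_def)
qed

lemma over2_mult:
  fixes X Y :: "('k, 'n) free_alg^'n^'n"
  shows "over2 R X ** over2 R Y = over2 R (X ** Y)"
  by (simp add: over2_eq leg1_mult matrix_mul_assoc)

lemma R_trace2_eqv: "X \<doteq>\<^sub>m Y \<Longrightarrow> R_trace2 \<Psi> X \<doteq> R_trace2 \<Psi> Y"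
  unfolding R_trace2_def by (intro trace_eqv mat_eqv_mult mat_eqv_refl)

lemmas R_trace2_cyclic = R_trace2_cyclic[OF inv skew]

lemma R_trace2_RA_conj [simp]: "R_trace2 \<Psi> (RA ** X ** RA) = R_trace2 \<Psi> X"
  by (simp add: R_trace2_cyclic[symmetric] matrix_mul_assoc)

lemma R_trace2_over1_over2:
  fixes X Y :: "('k, 'n) free_alg^'n^'n"
  shows "R_trace2 \<Psi> (over1 X ** over2 R Y) = R_trace \<Psi> X * R_trace \<Psi> Y"
  by (simp add: over1_def over2_eq R_trace2_leg1_R_leg1_R[OF inv skew])

text \<open>Conjugation by \<open>R\<close> exchanges the two overlined copies and preserves
  \<open>R_trace2\<close>, so this order of factors reduces to the previous one.\<close>

lemma R_trace2_over2_over1: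
  fixes X Y :: "('k, 'n) free_alg^'n^'n"
  shows "R_trace2 \<Psi> (over2 R Y ** over1 X) = R_trace \<Psi> Y * R_trace \<Psi> X"
proof -
  have "R_trace2 \<Psi> (over2 R Y ** over1 X) = R_trace2 \<Psi> (RA ** (over1 Y ** over2 R X) ** RA)"
    by (simp add: over1_def over2_eq matrix_mul_assoc)
  then show ?thesis by (simp add: R_trace2_over1_over2)
qed

lemma mixed_relation:
  assumes "k \<noteq> l"
  shows "over1 (gen k) ** over2 R (gen l) \<doteq>\<^sub>m over2 R (gen l) ** over1 (gen k)"
  unfolding mat_eqv_def eqv_def
proof (intro allI)
  fix i j
  have "mixed_relator R k l $ i $ j \<in> I"
    using assms relators unfolding relators_def by blast
  then show "(over1 (gen k) ** over2 R (gen l)) $ i $ j - (over2 R (gen l) ** over1 (gen k)) $ i $ j \<in> I"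
    by (simp add: mixed_relator_def)
qed

text \<open>Since \<open>R ** R = mat 1\<close>, the second overlined copy times \<open>R\<close> is
  \<open>R\<close> times the first copy; the correction thus becomes a commutator with
  \<open>R\<close>, which telescopes later.\<close>

lemma same_relation:
  "over1 (gen k) ** over2 R (gen k) \<doteq>\<^sub>m
     over2 R (gen k) ** over1 (gen k) + (over1 (gen k) ** RA - RA ** over1 (gen k))"
  unfolding mat_eqv_def eqv_def
proof (intro allI)
  fix i j
  have "same_relator R k $ i $ j \<in> I"
    using relators unfolding relators_def by blast
  moreover have "over2 R (gen k) ** RA = RA ** over1 (gen k)"
    by (simp add: over2_eq over1_def)
  ultimately show "(over1 (gen k) ** over2 R (gen k)) $ i $ j
    - (over2 R (gen k) ** over1 (gen k) + (over1 (gen k) ** RA - RA ** over1 (gen k))) $ i $ j \<in> I"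
    by (simp add: same_relator_def algebra_simps)
qed

lemma R_trace_mult_eq:
  fixes X Y :: "('k, 'n) free_alg^'n^'n"
  shows "R_trace \<Psi> (X ** Y) = R_trace2 \<Psi> (over1 X ** RA ** over1 Y)"
  by (simp add: over1_def R_trace2_leg1_R_leg1[OF skew])

text \<open>Inserting \<open>RA ** RA\<close> turns \<open>K R L\<close> into the first copy of
  \<open>M(k)\<close>, the second copy of \<open>M(l)\<close>, and \<open>R\<close>. After the mixed
  relation exchanges the copies, the product is a conjugate of \<open>L R K\<close>.\<close>

lemma \<Omega>_sym:
  assumes "k \<noteq> l" shows "\<Omega> k l \<doteq> \<Omega> l k"
proof -
  let ?K = "over1 (gen k)" and ?L = "over1 (gen l)"
  have "\<Omega> k l = R_trace2 \<Psi> (?K ** over2 R (gen l) ** RA)"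
    by (simp add: \<Omega>_def R_trace_mult_eq over2_eq over1_def matrix_mul_assoc)
  also have "\<dots> \<doteq> R_trace2 \<Psi> (over2 R (gen l) ** ?K ** RA)"
    by (intro R_trace2_eqv mat_eqv_mult mat_eqv_refl mixed_relation assms)
  also have "\<dots> = R_trace2 \<Psi> (RA ** (?L ** RA ** ?K) ** RA)"
    by (simp add: over2_eq over1_def matrix_mul_assoc)
  also have "\<dots> = \<Omega> l k"
    by (simp add: \<Omega>_def R_trace_mult_eq)
  finally show ?thesis .
qed

lemma \<Omega>_commute_disjoint:
  assumes "k \<noteq> p" "k \<noteq> q" "l \<noteq> p" "l \<noteq> q"
  shows "\<Omega> k l * \<Omega> p q \<doteq> \<Omega> p q * \<Omega> k l"
proof -
  let ?K = "over1 (gen k)" and ?L = "over1 (gen l)" and ?P = "over2 R (gen p)" and ?Q = "over2 R (gen q)"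
  \<comment> \<open>All four exchanges are mixed relations, so the correction \<open>D\<close> is
    zero.\<close>
  have "?K ** ?L ** (?P ** ?Q) \<doteq>\<^sub>m ?P ** ?Q ** (?K ** ?L) + ?K ** 0 ** ?Q"
    by (rule commutator_shared_right) (simp_all add: assms mixed_relation)
  then have "R_trace2 \<Psi> (?K ** ?L ** (?P ** ?Q)) \<doteq> R_trace2 \<Psi> (?P ** ?Q ** (?K ** ?L))"
    by (intro R_trace2_eqv) simp
  moreover have "?K ** ?L = over1 (gen k ** gen l)"
    by (simp add: over1_def leg1_mult)
  ultimately show ?thesis
    by (simp add: over2_mult R_trace2_over1_over2 R_trace2_over2_over1 \<Omega>_def)
qed

text \<open>Each of the two commutators leaves one correction term, from the index shared by its two
  pairs. The terms do not vanish separately; the trace of their sum does.\<close>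

lemma \<Omega>_infinitesimal_braid:
  assumes "k \<noteq> l" "k \<noteq> p" "l \<noteq> p"
  shows "\<Omega> k l * \<Omega> k p + \<Omega> k l * \<Omega> l p \<doteq> \<Omega> k p * \<Omega> k l + \<Omega> l p * \<Omega> k l"
proof -
  let ?X = "over1 (gen k)" and ?Y = "over1 (gen l)" and ?Z = "over1 (gen p)"
  let ?X' = "over2 R (gen k)" and ?Y' = "over2 R (gen l)" and ?Z' = "over2 R (gen p)"
  let ?D = "\<lambda>X. X ** RA - RA ** X"
  have "?X ** ?Y ** (?X' ** ?Z') \<doteq>\<^sub>m ?X' ** ?Z' ** (?X ** ?Y) + ?D ?X ** ?Y ** ?Z'"
    by (intro commutator_shared_left mixed_relation same_relation assms assms[symmetric])
  then have 1: "\<Omega> k l * \<Omega> k p \<doteq> \<Omega> k p * \<Omega> k l + R_trace2 \<Psi> (?D ?X ** ?Y ** ?Z')"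
    using R_trace2_eqv
    by (fastforce simp: over2_mult R_trace2_add over1_def leg1_mult[symmetric]
      R_trace2_over1_over2[unfolded over1_def] R_trace2_over2_over1[unfolded over1_def] \<Omega>_def)
  have "?X ** ?Y ** (?Y' ** ?Z') \<doteq>\<^sub>m ?Y' ** ?Z' ** (?X ** ?Y) + ?X ** ?D ?Y ** ?Z'"
    by (intro commutator_shared_right mixed_relation same_relation assms assms[symmetric])
  then have 2: "\<Omega> k l * \<Omega> l p \<doteq> \<Omega> l p * \<Omega> k l + R_trace2 \<Psi> (?X ** ?D ?Y ** ?Z')"
    using R_trace2_eqv
    by (fastforce simp: over2_mult R_trace2_add over1_def leg1_mult[symmetric]
      R_trace2_over1_over2[unfolded over1_def] R_trace2_over2_over1[unfolded over1_def] \<Omega>_def)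
  \<comment> \<open>The two commutators with \<open>R\<close> telescope to
    \<open>X Y R Z' - R X Y Z'\<close>; then \<open>Z' = R Z R\<close> is inserted.\<close>
  have "?D ?X ** ?Y ** ?Z' + ?X ** ?D ?Y ** ?Z' = ?X ** ?Y ** ?Z ** RA - RA ** (?X ** ?Y ** RA ** ?Z) ** RA"
    by (simp add: matrix_diff_rdistrib matrix_diff_ldistrib matrix_mul_assoc over2_eq over1_def)
  then have "R_trace2 \<Psi> (?D ?X ** ?Y ** ?Z') + R_trace2 \<Psi> (?X ** ?D ?Y ** ?Z')
     = R_trace2 \<Psi> (?X ** ?Y ** ?Z ** RA) - R_trace2 \<Psi> (?X ** ?Y ** RA ** ?Z)"
    by (simp add: R_trace2_add[symmetric] R_trace2_diff)
  also have "\<dots> = 0"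
  proof -
    \<comment> \<open>Both traces equal the R-trace of the triple product. For the first one, the
      trailing \<open>R\<close> is read as \<open>R\<close> followed by the first copy of the
      identity matrix.\<close>
    have "over1 (mat 1) = (mat 1 :: ('k, 'n) free_alg^_^_)"
      by (auto simp: over1_def leg1_def mat_def vec_eq_iff prod_eq_iff)
    then have "R_trace2 \<Psi> (?X ** ?Y ** ?Z ** RA) = R_trace \<Psi> (gen k ** gen l ** gen p)"
      using R_trace_mult_eq[of "gen k ** gen l ** gen p" "mat 1"] by (simp add: over1_def leg1_mult)
    moreover have "R_trace2 \<Psi> (?X ** ?Y ** RA ** ?Z) = R_trace \<Psi> (gen k ** gen l ** gen p)"
      by (simp add: R_trace_mult_eq over1_def leg1_mult)
    ultimately show ?thesis by simp
  qed
  finally have 3: "R_trace2 \<Psi> (?D ?X ** ?Y ** ?Z') + R_trace2 \<Psi> (?X ** ?D ?Y ** ?Z') = 0" .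
  have "\<Omega> k l * \<Omega> k p + \<Omega> k l * \<Omega> l p
    \<doteq> (\<Omega> k p * \<Omega> k l + R_trace2 \<Psi> (?D ?X ** ?Y ** ?Z')) + (\<Omega> l p * \<Omega> k l + R_trace2 \<Psi> (?X ** ?D ?Y ** ?Z'))"
    using 1 2 by (rule eqv_add)
  also have "\<dots> = \<Omega> k p * \<Omega> k l + \<Omega> l p * \<Omega> k l + (R_trace2 \<Psi> (?D ?X ** ?Y ** ?Z') + R_trace2 \<Psi> (?X ** ?D ?Y ** ?Z'))"
    by (simp only: add_ac)
  finally show ?thesis unfolding 3 by simp
qed

section \<open>From the infinitesimal braid relations to commuting Gaudin sums\<close>

lemma Gaudin_sums_commute:
  fixes u :: "'k \<Rightarrow> complex"
  assumes fin: "finite (UNIV :: 'k set)" and u: "inj u"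
  defines "H \<equiv> \<lambda>k. \<Sum>l\<in>UNIV - {k}. scalar (1 / (u k - u l)) * \<Omega> k l"
  shows "H k * H l \<doteq> H l * H k"
proof (cases "k = l")
  case False
  define c where "c i j = 1 / (u i - u j)" for i j
  define com where "com x y = x * y - y * x" for x y :: "('k, 'n) free_alg"
  \<comment> \<open>\<open>T a b\<close> is the contribution of the summand \<open>a\<close> of
    \<open>H k\<close> and the summand \<open>b\<close> of \<open>H l\<close> to the commutator of
    \<open>H k\<close> and \<open>H l\<close>.\<close>
  define T where "T a b = scalar (c k a * c l b) * com (\<Omega> k a) (\<Omega> l b)" for a b
  have H: "H k = (\<Sum>l\<in>UNIV - {k}. scalar (c k l) * \<Omega> k l)" for k
    by (simp add: H_def c_def)
  have com_cong: "com x y \<doteq> com x' y'" if "x \<doteq> x'" "y \<doteq> y'" for x y x' y'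
    unfolding com_def by (intro eqv_diff eqv_mult that)
  \<comment> \<open>On a triangle of three distinct indices, the commutator of two consecutive edges
    is the same, modulo \<open>I\<close>, for all cyclic shifts.\<close>
  have com_braid: "com (\<Omega> p i) (\<Omega> i j) \<doteq> com (\<Omega> i j) (\<Omega> j p)" if "i \<noteq> j" "i \<noteq> p" "j \<noteq> p" for i j p
  proof -
    have "com (\<Omega> p i) (\<Omega> i j) \<doteq> com (\<Omega> i p) (\<Omega> i j)"
      using that by (intro com_cong \<Omega>_sym eqv_refl) auto
    also have "\<dots> \<doteq> com (\<Omega> i j) (\<Omega> j p)"
      using eqv_sym[OF \<Omega>_infinitesimal_braid[OF that]] by (simp add: eqv_def com_def algebra_simps)
    finally show ?thesis .
  qed
  have diag: "T l k \<in> I"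
  proof -
    have "com (\<Omega> k l) (\<Omega> l k) \<doteq> com (\<Omega> k l) (\<Omega> k l)"
      using False by (intro com_cong \<Omega>_sym eqv_refl) auto
    then show ?thesis unfolding T_def
      by (intro lmult_mem) (simp add: eqv_def com_def)
  qed
  have disjoint: "T p q \<in> I" if "p \<noteq> k" "q \<noteq> k" "p \<noteq> l" "q \<noteq> l" "p \<noteq> q" for p q
    unfolding T_def com_def using \<Omega>_commute_disjoint[of k l q p, unfolded eqv_def] that False
    by (intro lmult_mem) simp
  \<comment> \<open>The three contributions that involve exactly the indices \<open>k\<close>,
    \<open>l\<close>, \<open>p\<close> are all multiples of one commutator \<open>?X\<close>, so
    only their coefficients need to cancel.\<close>
  have triple: "T l p + T p k + T p p \<in> I" if p: "p \<noteq> k" "p \<noteq> l" for p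
  proof -
    let ?X = "com (\<Omega> k l) (\<Omega> l p)"
    have "com (\<Omega> k p) (\<Omega> l k) \<doteq> com (\<Omega> p k) (\<Omega> k l)"
      using p False by (intro com_cong \<Omega>_sym) auto
    also have "\<dots> \<doteq> ?X"
      using p False by (intro com_braid) auto
    finally have 1: "com (\<Omega> k p) (\<Omega> l k) \<doteq> ?X" .
    have "com (\<Omega> k p) (\<Omega> l p) \<doteq> com (\<Omega> p k) (\<Omega> l p)"
      using p False by (intro com_cong \<Omega>_sym eqv_refl) auto
    also have "\<dots> = 0 - com (\<Omega> l p) (\<Omega> p k)"
      by (simp add: com_def)
    also have "\<dots> \<doteq> 0 - ?X"
      using p False by (intro eqv_diff eqv_refl eqv_sym[OF com_braid]) auto
    finally have 2: "com (\<Omega> k p) (\<Omega> l p) \<doteq> 0 - ?X" .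
    have "T l p + T p k + T p p
      \<doteq> scalar (c k l * c l p) * ?X + scalar (c k p * c l k) * ?X
        + scalar (c k p * c l p) * (0 - ?X)"
      unfolding T_def by (intro eqv_add eqv_mult eqv_refl 1 2)
    also have "\<dots> = (scalar (c k l * c l p + c k p * c l k) - scalar (c k p * c l p)) * ?X"
      by (simp add: scalar_add algebra_simps)
    \<comment> \<open>Partial fractions: over the common denominator
      \<open>(u k - u l) * (u l - u p) * (u k - u p)\<close> the left side has numerator
      \<open>(u k - u p) - (u l - u p) = u k - u l\<close>.\<close>
    also have "c k l * c l p + c k p * c l k = c k p * c l p"
    proof -
      have "u k \<noteq> u l" "u k \<noteq> u p" "u l \<noteq> u p"
        using p False u by (auto dest: injD)
      then show ?thesis unfolding c_def by (simp add: divide_simps) (simp add: algebra_simps)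
    qed
    finally show ?thesis by (simp add: eqv_def)
  qed
  define S where "S = UNIV - {k, l}"
  have S: "finite S" "k \<notin> S" "l \<notin> S" "UNIV - {k} = insert l S" "UNIV - {l} = insert k S"
    using False finite_subset[OF subset_UNIV fin] by (auto simp: S_def)
  have "H k * H l - H l * H k = (\<Sum>a\<in>UNIV - {k}. \<Sum>b\<in>UNIV - {l}. T a b)"
  proof -
    have scal: "(scalar x * A) * (scalar y * B) = scalar (x * y) * (A * B)" for x y and A B :: "('k, 'n) free_alg"
      by (simp add: scalar_mult mult.assoc scalar_left_commute[of A])
    \<comment> \<open>The sums are exchanged so that both products are indexed by the same pairs
      \<open>(a, b)\<close> and can be subtracted termwise.\<close>
    have "H l * H k = (\<Sum>a\<in>UNIV - {k}. \<Sum>b\<in>UNIV - {l}. (scalar (c l b) * \<Omega> l b) * (scalar (c k a) * \<Omega> k a))"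
      unfolding H sum_product by (rule sum.swap)
    then show ?thesis
      unfolding H[of k] H[of l] sum_product
      by (simp add: scal T_def com_def sum_subtractf right_diff_distrib mult.commute[of "c k _"])
  qed
  also have "\<dots> = T l k + (\<Sum>p\<in>S. T l p) + (\<Sum>p\<in>S. T p k + (\<Sum>q\<in>S. T p q))"
    unfolding S(4,5) using S(1-3) by simp
  \<comment> \<open>The terms with \<open>q = p\<close> leave the double sum to complete the
    triples; what remains there has disjoint index pairs \<open>{k, p}\<close> and
    \<open>{l, q}\<close>.\<close>
  also have "\<dots> = T l k + (\<Sum>p\<in>S. (T l p + T p k + T p p) + (\<Sum>q\<in>S - {p}. T p q))"
  proof -
    have "(\<Sum>q\<in>S. T p q) = T p p + (\<Sum>q\<in>S - {p}. T p q)" if "p \<in> S" for p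
      using S(1) that by (rule sum.remove)
    then show ?thesis
      by (simp add: sum.distrib add.assoc)
  qed
  also have "\<dots> \<in> I"
    by (intro add_mem sum_mem diag triple disjoint) (auto simp: S_def)
  finally show ?thesis by (simp add: eqv_def)
qed simp

end

theorem mainTheorem4:
  fixes R \<Psi> :: "complex^('n::finite \<times> 'n)^('n \<times> 'n)"
    and m :: nat
    and u :: "'k::finite \<Rightarrow> complex"
  assumes "involutive_symmetry R"
    and "skew_inverse R \<Psi>"
    and "even_birank R m"
    and "inj u"
  shows "\<forall>k l. Ham R \<Psi> u k \<otimes>\<^bsub>gaudin_alg R\<^esub> Ham R \<Psi> u l
             = Ham R \<Psi> u l \<otimes>\<^bsub>gaudin_alg R\<^esub> Ham R \<Psi> u k"
proof -
  interpret two_sided_ideal "rel_ideal R :: ('k, 'n) free_alg set"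
    by (rule two_sided_ideal_rel_ideal)
  interpret gaudin "rel_ideal R :: ('k, 'n) free_alg set" R \<Psi>
    by unfold_locales (simp_all add: assms relators_subset_rel_ideal)
  \<comment> \<open>Products of cosets are cosets of products, so equality in the quotient is
    exactly the congruence modulo \<open>rel_ideal R\<close>.\<close>
  show ?thesis
    using Gaudin_sums_commute[OF finite assms(4)]
    unfolding Ham_def to_alg_mult to_alg_eq_iff eqv_def \<Omega>_def by blast
qed

end
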